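(* Consider a project (as defined in the context), and suppose that $\underline g(x,z)=\inf_{k\ge0} g_k(x,z)>0$ for any state $x\in\mathsf X$ and threshold $z\in\overline{\mathbb R}$. Then, for any state $x$, threshold $z$ and integer $k\ge0$: (a) $|m_k(x,z)-m(x,z)|\le 2M_\gamma\gamma^k w(x)\,(1+|m(x,z)|)/\underline g(x,z)$; (b) $|m_k(x)-m(x)|\le 2M_\gamma\gamma^k w(x)\,(1+|m(x)|)/\underline g(x,x)$.
   Context: Project model. $\mathsf X=\{x\in\mathbb R:\ell\le x\le u\}$ with $-\infty\le\ell<u\le\infty$; all sets and functions are Borel measurable. A project has state $X_t\in\mathsf X$ and action $A_t\in\{0,1\}$ ($1$ = active, $0$ = passive) at times $t=0,1,\dots$. When $(X_t,A_t)=(x,a)$ it yields reward $r(x,a)$, consumes $c(x,a)$ units of a resource, and $X_{t+1}\sim\kappa^a(x,\cdot)$, with $\kappa^0,\kappa^1$ Markov transition kernels on $\mathsf X$. The discount factor is $\beta\in[0,1)$. Standing assumption: for each $a\in\{0,1\}$, $r(\cdot,a)$ and $c(\cdot,a)$ are continuous on $\mathsf X$, $0\le c(x,0)<c(x,1)$ for all $x$, and there are a function $w:\mathsf X\to[1,\infty)$ and constants $M>0$, $\beta\le\gamma<1$ with $\max\{|r(x,a)|,c(x,a)\}\le M w(x)$ and $\beta\int w(y)\,\kappa^a(x,dy)\le\gamma w(x)$ for all $x,a$. $M_\gamma=M/(1-\gamma)$. Metrics. For a nonanticipative policy $\pi$ and $X_0=x$, $F(x,\pi)=\mathsf E_x^\pi[\sum_{t\ge0}\beta^t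 r(X_t,A_t)]$, $G(x,\pi)=\mathsf E_x^\pi[\sum_{t\ge0}\beta^t c(X_t,A_t)]$. For $z\in\overline{\mathbb R}=\mathbb R\cup\{-\infty,\infty\}$ the $z$-policy takes $A_t=1$ iff $X_t>z$. For an action $a$ and a policy $\pi$, $\langle a,\pi\rangle$ takes action $a$ at time $0$ and follows $\pi$ afterwards. $f(x,z)=F(x,\langle1,z\rangle)-F(x,\langle0,z\rangle)$ and $g(x,z)=G(x,\langle1,z\rangle)-G(x,\langle0,z\rangle)$, with $z$ standing for the $z$-policy; $m(x,z)=f(x,z)/g(x,z)$ when $g(x,z)\neq 0$, and $m(x)=m(x,x)$. Finite-horizon metrics. $F_k(x,z)=\mathsf E_x^z[\sum_{t=0}^k\beta^t r(X_t,A_t)]$ and $G_k(x,z)=\mathsf E_x^z[\sum_{t=0}^k\beta^t c(X_t,A_t)]$ under the $z$-policy. $f_0(x,z)=r(x,1)-r(x,0)$, $g_0(x,z)=c(x,1)-c(x,0)$, and for $k\ge1$, $f_k(x,z)=r(x,1)-r(x,0)+\beta\int F_{k-1}(y,z)\,\kappa^1(x,dy)-\beta\int F_{k-1}(y,z)\,\kappa^0(x,dy)$, $g_k(x,z)=c(x,1)-c(x,0)+\beta\int G_{k-1}(y,z)\,\kappa^1(x,dy)-\beta\int G_{k-1}(y,z)\,\kappa^0(x,dy)$. $m_k(x,z)=f_k(x,z)/g_k(x,z)$ when $g_k(x,z)\ne0$, and $m_k(x)=m_k(x,x)$. *)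

theory Defs
  imports "HOL-Probability.Probability"
begin

text \<open>
  Actions are Booleans: \<^term>\<open>True\<close> is active, \<^term>\<open>False\<close> is passive. Endpoints of the state
  interval are extended reals, so that unbounded intervals are covered; states are always real.
\<close>

record project =
  lo :: ereal
  up :: ereal
  kernel :: "bool \<Rightarrow> real \<Rightarrow> real measure"
  reward :: "real \<Rightarrow> bool \<Rightarrow> real"
  resource :: "real \<Rightarrow> bool \<Rightarrow> real"
  disc :: real

definition states :: "project \<Rightarrow> real set" where
  "states P = {x. lo P \<le> ereal x \<and> ereal x \<le> up P}"

definition state_space :: "project \<Rightarrow> real measure" where
  "state_space P = restrict_space borel (states P)"

definition state_action_space :: "project \<Rightarrow> (real \<times> bool) measure" where
  "state_action_space P = state_space P \<Otimes>\<^sub>M count_space UNIV"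

text \<open>
  The weighted drift condition is stated with the Lebesgue integral of nonnegative functions, so
  that it forces \<open>w\<close> to be integrable whenever the discount factor is positive.
\<close>

locale project_model =
  fixes P :: project and w :: "real \<Rightarrow> real" and M \<gamma> :: real
  assumes interval: "lo P < up P"
    and kernel: "\<And>a. kernel P a \<in> state_space P \<rightarrow>\<^sub>M prob_algebra (state_space P)"
    and disc: "0 \<le> disc P" "disc P < 1"
    and reward_cont: "\<And>a. continuous_on (states P) (\<lambda>x. reward P x a)"
    and resource_cont: "\<And>a. continuous_on (states P) (\<lambda>x. resource P x a)"
    and resource_order: "\<And>x. x \<in> states P \<Longrightarrow>
      0 \<le> resource P x False \<and> resource P x False < resource P x True"
    and weight_measurable: "w \<in> borel_measurable (state_space P)"
    and weight_ge_1: "\<And>x. x \<in> states P \<Longrightarrow> 1 \<le> w x"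
    and M_pos: "0 < M"
    and \<gamma>: "disc P \<le> \<gamma>" "\<gamma> < 1"
    and weight_bound: "\<And>x a. x \<in> states P \<Longrightarrow>
      max \<bar>reward P x a\<bar> (resource P x a) \<le> M * w x"
    and weight_drift: "\<And>x a. x \<in> states P \<Longrightarrow>
      ennreal (disc P) * (\<integral>\<^sup>+ y. ennreal (w y) \<partial>kernel P a x) \<le> ennreal (\<gamma> * w x)"

text \<open>
  A policy maps the time \<open>t\<close>, the history of state-action pairs at times \<open>0, \<dots>, t - 1\<close> (a
  function that is \<^term>\<open>undefined\<close> from \<open>t\<close> on) and the current state to a distribution over
  actions. Policies may thus depend on the history and may randomize.
\<close>

type_synonym policy = "nat \<Rightarrow> (nat \<Rightarrow> real \<times> bool) \<Rightarrow> real \<Rightarrow> bool measure"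

definition nonanticipative :: "project \<Rightarrow> policy \<Rightarrow> bool" where
  "nonanticipative P \<pi> \<longleftrightarrow>
    (\<forall>t. (\<lambda>(h, x). \<pi> t h x) \<in> PiM {0..<t} (\<lambda>_. state_action_space P) \<Otimes>\<^sub>M state_space P
      \<rightarrow>\<^sub>M prob_algebra (count_space UNIV))"

definition threshold_policy :: "ereal \<Rightarrow> policy" where
  "threshold_policy z t h x = return (count_space UNIV) (z < ereal x)"

text \<open>
  After the initial action, the policy \<open>\<pi>\<close> is started afresh at time \<open>1\<close>: it sees the history
  with time \<open>0\<close> dropped and the clock shifted.
\<close>

definition action_then :: "bool \<Rightarrow> policy \<Rightarrow> policy" where
  "action_then a \<pi> t h x =
    (if t = 0 then return (count_space UNIV) a
     else \<pi> (t - 1) (\<lambda>i\<in>{0..<t - 1}. h (Suc i)) x)"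

text \<open>Conditional law of the state-action pair at time \<open>t\<close> given the history, and initial state \<open>x\<close>.\<close>

definition step :: "project \<Rightarrow> policy \<Rightarrow> real \<Rightarrow> nat \<Rightarrow> (nat \<Rightarrow> real \<times> bool) \<Rightarrow> (real \<times> bool) measure"
  where
  "step P \<pi> x t h =
    (if t = 0 then return (state_space P) x
     else kernel P (snd (h (t - 1))) (fst (h (t - 1)))) \<bind>
    (\<lambda>y. distr (\<pi> t h y) (state_action_space P) (Pair y))"

text \<open>
  The law of the whole state-action process is the projective limit given by the Ionescu Tulcea
  theorem.
\<close>

definition law :: "project \<Rightarrow> policy \<Rightarrow> real \<Rightarrow> (nat \<Rightarrow> real \<times> bool) measure" where
  "law P \<pi> x =
    projective_family.lim UNIV
      (Ionescu_Tulcea.CI (step P \<pi> x) (\<lambda>_. state_action_space P)) (\<lambda>_. state_action_space P)"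

definition F_metric :: "project \<Rightarrow> real \<Rightarrow> policy \<Rightarrow> real" where
  "F_metric P x \<pi> = (\<integral>\<omega>. (\<Sum>t. disc P ^ t * reward P (fst (\<omega> t)) (snd (\<omega> t))) \<partial>law P \<pi> x)"

definition G_metric :: "project \<Rightarrow> real \<Rightarrow> policy \<Rightarrow> real" where
  "G_metric P x \<pi> = (\<integral>\<omega>. (\<Sum>t. disc P ^ t * resource P (fst (\<omega> t)) (snd (\<omega> t))) \<partial>law P \<pi> x)"

definition f_metric :: "project \<Rightarrow> real \<Rightarrow> ereal \<Rightarrow> real" where
  "f_metric P x z = F_metric P x (action_then True (threshold_policy z))
    - F_metric P x (action_then False (threshold_policy z))"

definition g_metric :: "project \<Rightarrow> real \<Rightarrow> ereal \<Rightarrow> real" where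
  "g_metric P x z = G_metric P x (action_then True (threshold_policy z))
    - G_metric P x (action_then False (threshold_policy z))"

definition m_metric :: "project \<Rightarrow> real \<Rightarrow> ereal \<Rightarrow> real" where
  "m_metric P x z = f_metric P x z / g_metric P x z"

definition F_fin :: "project \<Rightarrow> nat \<Rightarrow> real \<Rightarrow> ereal \<Rightarrow> real" where
  "F_fin P k x z =
    (\<integral>\<omega>. (\<Sum>t\<le>k. disc P ^ t * reward P (fst (\<omega> t)) (snd (\<omega> t))) \<partial>law P (threshold_policy z) x)"

definition G_fin :: "project \<Rightarrow> nat \<Rightarrow> real \<Rightarrow> ereal \<Rightarrow> real" where
  "G_fin P k x z =
    (\<integral>\<omega>. (\<Sum>t\<le>k. disc P ^ t * resource P (fst (\<omega> t)) (snd (\<omega> t))) \<partial>law P (threshold_policy z) x)"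

fun f_fin :: "project \<Rightarrow> nat \<Rightarrow> real \<Rightarrow> ereal \<Rightarrow> real" where
  "f_fin P 0 x z = reward P x True - reward P x False"
| "f_fin P (Suc k) x z = reward P x True - reward P x False
    + disc P * (\<integral>y. F_fin P k y z \<partial>kernel P True x)
    - disc P * (\<integral>y. F_fin P k y z \<partial>kernel P False x)"

fun g_fin :: "project \<Rightarrow> nat \<Rightarrow> real \<Rightarrow> ereal \<Rightarrow> real" where
  "g_fin P 0 x z = resource P x True - resource P x False"
| "g_fin P (Suc k) x z = resource P x True - resource P x False
    + disc P * (\<integral>y. G_fin P k y z \<partial>kernel P True x)
    - disc P * (\<integral>y. G_fin P k y z \<partial>kernel P False x)"

definition m_fin :: "project \<Rightarrow> nat \<Rightarrow> real \<Rightarrow> ereal \<Rightarrow> real" where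
  "m_fin P k x z = f_fin P k x z / g_fin P k x z"

text \<open>
  In a project model the values \<open>g_fin P k x z\<close> are bounded in \<open>k\<close>, so that this conditionally
  complete infimum is the actual one.
\<close>

definition g_inf :: "project \<Rightarrow> real \<Rightarrow> ereal \<Rightarrow> real" where
  "g_inf P x z = (INF k. g_fin P k x z)"

definition m_diag :: "project \<Rightarrow> real \<Rightarrow> real" where
  "m_diag P x = m_metric P x (ereal x)"

definition m_fin_diag :: "project \<Rightarrow> nat \<Rightarrow> real \<Rightarrow> real" where
  "m_fin_diag P k x = m_fin P k x (ereal x)"


text \<open>The policies in use are admissible, and admissible policies have a well-defined law.\<close>

lemma space_state_space [simp]: "space (state_space P) = states P"
  by (simp add: state_space_def space_restrict_space)

lemma nonanticipative_threshold_policy: "nonanticipative P (threshold_policy z)"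
proof -
  have "(\<lambda>x. z < ereal x) \<in> state_space P \<rightarrow>\<^sub>M count_space UNIV"
    unfolding state_space_def by (rule measurable_restrict_space1) measurable
  then have [measurable]: "Measurable.pred (state_space P) (\<lambda>x. z < ereal x)" .
  show ?thesis
    unfolding nonanticipative_def threshold_policy_def split_beta
    by (intro allI measurable_compose[OF _ measurable_return_prob_space]) measurable
qed

lemma nonanticipative_action_then:
  assumes "nonanticipative P \<pi>"
  shows "nonanticipative P (action_then a \<pi>)"
  unfolding nonanticipative_def
proof
  fix t
  let ?S = "state_action_space P" and ?X = "state_space P"
  show "(\<lambda>(h, x). action_then a \<pi> t h x) \<in> PiM {0..<t} (\<lambda>_. ?S) \<Otimes>\<^sub>M ?X
      \<rightarrow>\<^sub>M prob_algebra (count_space UNIV)"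
  proof (cases t)
    case 0
    have "return (count_space UNIV) a \<in> space (prob_algebra (count_space UNIV))"
      by (simp add: space_prob_algebra prob_space_return)
    then show ?thesis by (simp add: 0 action_then_def split_beta)
  next
    case (Suc s)
    have 1: "(\<lambda>(h, x). \<pi> s h x) \<in> PiM {0..<s} (\<lambda>_. ?S) \<Otimes>\<^sub>M ?X \<rightarrow>\<^sub>M prob_algebra (count_space UNIV)"
      using assms by (simp add: nonanticipative_def)
    have "(\<lambda>p. (\<lambda>i\<in>{0..<s}. fst p (Suc i), snd p)) \<in> PiM {0..<t} (\<lambda>_. ?S) \<Otimes>\<^sub>M ?X
        \<rightarrow>\<^sub>M PiM {0..<s} (\<lambda>_. ?S) \<Otimes>\<^sub>M ?X"
      by (intro measurable_Pair measurable_snd measurable_restrict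
          measurable_compose[OF measurable_fst measurable_component_singleton]) (auto simp: Suc)
    from measurable_compose[OF this 1] show ?thesis
      by (simp add: Suc action_then_def split_beta)
  qed
qed

lemma (in project_model) Ionescu_Tulcea_step:
  assumes \<pi>: "nonanticipative P \<pi>" and x: "x \<in> states P"
  shows "Ionescu_Tulcea (step P \<pi> x) (\<lambda>_. state_action_space P)"
proof -
  let ?S = "state_action_space P" and ?X = "state_space P"
  have "step P \<pi> x t \<in> PiM {0..<t} (\<lambda>_. ?S) \<rightarrow>\<^sub>M prob_algebra ?S" for t
  proof -
    let ?H = "PiM {0..<t} (\<lambda>_. ?S)"
    have "(\<lambda>h. if t = 0 then return ?X x else kernel P (snd (h (t - 1))) (fst (h (t - 1))))
        \<in> ?H \<rightarrow>\<^sub>M prob_algebra ?X"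
    proof (cases "t = 0")
      case True
      have "return ?X x \<in> space (prob_algebra ?X)"
        using x by (simp add: space_prob_algebra prob_space_return)
      then show ?thesis by (simp add: True)
    next
      case False
      have "(\<lambda>h. h (t - 1)) \<in> ?H \<rightarrow>\<^sub>M ?S"
        using False by (intro measurable_component_singleton) auto
      moreover have "(\<lambda>p. kernel P (snd p) (fst p)) \<in> ?S \<rightarrow>\<^sub>M prob_algebra ?X"
        unfolding state_action_space_def
        by (rule measurable_compose_countable'[where I = UNIV and g = snd and f = "\<lambda>a p. kernel P a (fst p)"])
          (auto intro!: measurable_compose[OF measurable_fst kernel])
      ultimately show ?thesis
        using False by (auto intro: measurable_compose)
    qed
    moreover have "(\<lambda>(h, y). distr (\<pi> t h y) ?S (Pair y)) \<in> ?H \<Otimes>\<^sub>M ?X \<rightarrow>\<^sub>M prob_algebra ?S"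
      unfolding split_beta
    proof (rule measurable_distr_prob_space2[where M = "count_space UNIV"])
      show "(\<lambda>p. \<pi> t (fst p) (snd p)) \<in> ?H \<Otimes>\<^sub>M ?X \<rightarrow>\<^sub>M prob_algebra (count_space UNIV)"
        using \<pi> unfolding nonanticipative_def split_beta by blast
      show "(\<lambda>(p, b). (snd p, b)) \<in> (?H \<Otimes>\<^sub>M ?X) \<Otimes>\<^sub>M count_space UNIV \<rightarrow>\<^sub>M ?S"
        unfolding state_action_space_def by measurable
    qed
    ultimately show ?thesis
      unfolding step_def[abs_def] by (rule measurable_bind_prob_space2)
  qed
  note step = this
  show ?thesis
    by (rule Ionescu_Tulcea.intro)
      (use measurable_space[OF step] in \<open>auto simp: space_prob_algebra intro: measurable_prob_algebraD[OF step]\<close>)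
qed

end

theory Submission
  imports Defs
begin

text \<open>
  Under the policy that takes action \<open>a\<close> first and the threshold policy afterwards, the state-action
  pairs form a Markov chain. By the drift condition the discounted stage reward at time \<open>t\<close> has
  expected absolute value at most \<open>M \<gamma>\<^sup>t w x\<close>. Conditioning on the first transition identifies
  \<open>f\<^sub>k\<close> and \<open>g\<^sub>k\<close> with differences of partial sums of the series for \<open>F\<close> and \<open>G\<close>, so that
  \<open>\<bar>f\<^sub>k - f\<bar>\<close> and \<open>\<bar>g\<^sub>k - g\<bar>\<close> are geometric tails, at most \<open>2 M\<^sub>\<gamma> \<gamma>\<^sup>k w x\<close>. In particular
  \<open>g \<ge> inf g\<^sub>k > 0\<close>, and the claim follows from
  \<open>m\<^sub>k - m = ((f\<^sub>k - f) - m (g\<^sub>k - g)) / g\<^sub>k\<close>.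
\<close>

section \<open>One-time marginals of the Ionescu Tulcea limit\<close>

text \<open>The limit is accessible through its finite projections. On the indices below
  \<open>Suc n\<close> it is \<open>C 0 n\<close> followed by \<open>eP n\<close>, which appends a
  sample of \<open>P n\<close> at coordinate \<open>n\<close>; reading that coordinate undoes the
  appending.\<close>

lemma (in Ionescu_Tulcea) distr_lim_component:
  "distr PF.lim (M n) (\<lambda>\<omega>. \<omega> n) = C 0 n (\<lambda>_. undefined) \<bind> P n"
proof -
  let ?C = "C 0 (Suc n) (\<lambda>_. undefined)"
  \<comment> \<open>\<open>CI\<close> restricts the process run up to time \<open>up_to J\<close> to
    the index set \<open>J\<close>; for an initial segment this restriction is trivial.\<close>
  have up: "up_to {0..<Suc n} = Suc n"
    using up_to_iff_Ico[of "{0..<Suc n}" "Suc n"] up_to[of "{0..<Suc n}"]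
    by (intro antisym) (simp_all add: subset_iff Suc_le_eq)
  have eq: "distr PF.lim (PiM {0..<Suc n} M) (\<lambda>\<omega>. restrict \<omega> {0..<Suc n}) = ?C"
  proof -
    have "distr PF.lim (PiM {0..<Suc n} M) (\<lambda>\<omega>. restrict \<omega> {0..<Suc n}) = CI {0..<Suc n}"
      by (rule distr_lim) simp
    also have "\<dots> = ?C"
      unfolding CI_def up using distr_C[of "Suc n" "Suc n" "\<lambda>_. undefined" 0] by simp
    finally show ?thesis .
  qed
  have "distr PF.lim (M n) (\<lambda>\<omega>. \<omega> n) =
      distr (distr PF.lim (PiM {0..<Suc n} M) (\<lambda>\<omega>. restrict \<omega> {0..<Suc n})) (M n) (\<lambda>\<omega>. \<omega> n)"
    by (subst distr_distr) (auto intro!: distr_cong measurable_restrict measurable_component_singleton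
        simp: comp_def measurable_cong_sets[OF PF.sets_lim])
  also have "\<dots> = distr (C 0 n (\<lambda>_. undefined) \<bind> eP n) (M n) (\<lambda>\<omega>. \<omega> n)"
    unfolding eq by simp
  also have "\<dots> = C 0 n (\<lambda>_. undefined) \<bind> (\<lambda>h. distr (eP n h) (M n) (\<lambda>\<omega>. \<omega> n))"
    by (rule distr_bind[where K = "PiM {0..<Suc n} M"])
      (auto simp: space_C measurable_cong_sets[OF sets_C] space_PiM_empty_iff)
  also have "\<dots> = C 0 n (\<lambda>_. undefined) \<bind> P n"
  proof (rule bind_cong[OF refl])
    fix h assume "h \<in> space (C 0 n (\<lambda>_. undefined))"
    then have h: "h \<in> space (PiM {0..<n} M)" by (simp add: space_C)
    have "distr (eP n h) (M n) (\<lambda>\<omega>. \<omega> n) = distr (P n h) (M n) (\<lambda>x. x)"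
      unfolding eP_def using h
      by (subst distr_distr)
        (auto simp: comp_def measurable_cong_sets[OF sets_P]
          intro!: measurable_fun_upd[where J="{0..<n}"] measurable_component_singleton)
    then show "distr (eP n h) (M n) (\<lambda>\<omega>. \<omega> n) = P n h"
      using h by (simp add: distr_id2 sets_P)
  qed
  finally show ?thesis .
qed

text \<open>The Markov property at the level of marginals: once \<open>x\<close> is appended to the
  history at \<open>n\<close>, the next kernel sees only \<open>x\<close>, so associativity of
  \<open>bind\<close> moves \<open>Q\<close> outside the history.\<close>

lemma (in Ionescu_Tulcea) distr_lim_component_Suc:
  assumes Q[measurable]: "Q \<in> M n \<rightarrow>\<^sub>M subprob_algebra (M (Suc n))"
    and P_Q: "\<And>h. h \<in> space (PiM {0..<Suc n} M) \<Longrightarrow> P (Suc n) h = Q (h n)"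
  shows "distr PF.lim (M (Suc n)) (\<lambda>\<omega>. \<omega> (Suc n)) = distr PF.lim (M n) (\<lambda>\<omega>. \<omega> n) \<bind> Q"
proof -
  let ?C = "C 0 n (\<lambda>_. undefined)"
  have "distr PF.lim (M (Suc n)) (\<lambda>\<omega>. \<omega> (Suc n)) = (?C \<bind> eP n) \<bind> P (Suc n)"
    by (simp add: distr_lim_component)
  also have "\<dots> = ?C \<bind> (\<lambda>h. eP n h \<bind> P (Suc n))"
    by (rule bind_assoc[where N = "PiM {0..<Suc n} M" and R = "M (Suc n)"])
      (simp_all add: measurable_cong_sets[OF sets_C])
  also have "\<dots> = ?C \<bind> (\<lambda>h. P n h \<bind> Q)"
  proof (rule bind_cong[OF refl])
    fix h assume "h \<in> space ?C"
    then have h: "h \<in> space (PiM {0..<n} M)" by (simp add: space_C)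
    have upd: "fun_upd h n \<in> P n h \<rightarrow>\<^sub>M PiM {0..<Suc n} M"
      using h by (auto simp: measurable_cong_sets[OF sets_P] intro!: measurable_fun_upd[where J="{0..<n}"])
    have "eP n h \<bind> P (Suc n) = P n h \<bind> (\<lambda>x. P (Suc n) (fun_upd h n x))"
      unfolding eP_def
      by (rule bind_distr[OF upd P]) (simp add: space_P[OF h])
    also have "\<dots> = P n h \<bind> Q"
      using measurable_space[OF upd] by (auto intro!: bind_cong simp: P_Q)
    finally show "eP n h \<bind> P (Suc n) = P n h \<bind> Q" .
  qed
  also have "\<dots> = (?C \<bind> P n) \<bind> Q"
    by (rule bind_assoc[where N = "M n" and R = "M (Suc n)", symmetric])
      (simp_all add: measurable_cong_sets[OF sets_C])
  finally show ?thesis by (simp add: distr_lim_component)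
qed

section \<open>Iterated integration of signed functions against a composed kernel\<close>

text \<open>Integrability of \<open>f\<close> under the composition gives integrability under
  \<open>N x\<close> only for almost every \<open>x\<close>. The nonnegative theorem is therefore
  applied to positive and negative parts, both dominated by the absolute value of
  \<open>f\<close>.\<close>

lemma
  fixes f :: "'b \<Rightarrow> real"
  assumes N[measurable]: "N \<in> M \<rightarrow>\<^sub>M subprob_algebra K"
    and int: "integrable (M \<bind> N) f"
    and f[measurable]: "f \<in> borel_measurable K"
  shows integrable_bind_inner: "integrable M (\<lambda>x. \<integral>y. f y \<partial>N x)"
    and integral_bind_integrable: "(\<integral>y. f y \<partial>(M \<bind> N)) = (\<integral>x. \<integral>y. f y \<partial>N x \<partial>M)"
proof -
  have fN[measurable]: "f \<in> borel_measurable (N x)" if "x \<in> space M" for x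
    using that by (simp add: measurable_cong_sets[OF sets_kernel[OF N that]])
  have meas[measurable]: "(\<lambda>x. \<integral>y. f y \<partial>N x) \<in> borel_measurable M"
    by measurable
  \<comment> \<open>Since \<open>ennreal\<close> sends negative reals to 0, \<open>n f\<close> and
    \<open>n (\<lambda>y. - f y)\<close> integrate the positive and the negative part of
    \<open>f\<close>.\<close>
  define n where "n g x = (\<integral>\<^sup>+y. ennreal (g y) \<partial>N x)" for g :: "'b \<Rightarrow> real" and x
  have n_meas[measurable]: "n g \<in> borel_measurable M" if [measurable]: "g \<in> borel_measurable K" for g
    unfolding n_def by measurable
  have n_int: "(\<integral>\<^sup>+x. n g x \<partial>M) = (\<integral>\<^sup>+y. ennreal (g y) \<partial>(M \<bind> N))"
    if [measurable]: "g \<in> borel_measurable K" for g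
    unfolding n_def by (rule nn_integral_bind[symmetric, where B=K]) measurable
  have abs_fin: "(\<integral>\<^sup>+y. ennreal \<bar>f y\<bar> \<partial>(M \<bind> N)) < \<infinity>"
    using int by (simp add: integrable_iff_bounded)
  have AE_abs: "AE x in M. n (\<lambda>y. \<bar>f y\<bar>) x \<noteq> \<infinity>"
    using abs_fin by (intro nn_integral_PInf_AE) (simp_all add: n_int)
  have AE_int: "AE x in M. integrable (N x) f"
    using AE_abs AE_space
    by eventually_elim (auto simp: integrable_iff_bounded n_def less_top)
  have ptw: "ennreal \<bar>\<integral>y. f y \<partial>N x\<bar> \<le> n (\<lambda>y. \<bar>f y\<bar>) x" if "integrable (N x) f" for x
    using integral_norm_bound_ennreal[OF that] by (simp add: n_def)
  show "integrable M (\<lambda>x. \<integral>y. f y \<partial>N x)"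
  proof (rule integrableI_bounded[OF meas])
    have "(\<integral>\<^sup>+x. ennreal (norm (\<integral>y. f y \<partial>N x)) \<partial>M) \<le> (\<integral>\<^sup>+x. n (\<lambda>y. \<bar>f y\<bar>) x \<partial>M)"
      using AE_int by (intro nn_integral_mono_AE) (auto elim!: eventually_mono simp: ptw)
    with abs_fin show "(\<integral>\<^sup>+x. ennreal (norm (\<integral>y. f y \<partial>N x)) \<partial>M) < \<infinity>"
      by (simp add: n_int)
  qed
  have part: "integrable M (\<lambda>x. enn2real (n g x))"
      "(\<integral>x. enn2real (n g x) \<partial>M) = enn2real (\<integral>\<^sup>+y. ennreal (g y) \<partial>(M \<bind> N))"
    if [measurable]: "g \<in> borel_measurable K" and le: "\<And>y. g y \<le> \<bar>f y\<bar>" for g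
  proof -
    \<comment> \<open>\<open>enn2real\<close> turns an infinite value into 0, so finiteness almost
      everywhere is what makes the passage to reals lossless.\<close>
    have "AE x in M. ennreal (enn2real (n g x)) = n g x"
      using AE_abs
    proof eventually_elim
      case (elim x)
      have "n g x \<le> n (\<lambda>y. \<bar>f y\<bar>) x"
        unfolding n_def by (intro nn_integral_mono ennreal_leI le)
      with elim show ?case by (auto intro!: ennreal_enn2real simp: less_top top_unique)
    qed
    then have eq: "(\<integral>\<^sup>+x. ennreal (enn2real (n g x)) \<partial>M) = (\<integral>\<^sup>+y. ennreal (g y) \<partial>(M \<bind> N))"
      by (simp add: nn_integral_cong_AE n_int[symmetric])
    have fin: "(\<integral>\<^sup>+y. ennreal (g y) \<partial>(M \<bind> N)) < \<infinity>"
      using le_less_trans[OF nn_integral_mono abs_fin] le by (meson ennreal_leI)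
    show "integrable M (\<lambda>x. enn2real (n g x))"
      using eq fin by (intro integrableI_bounded) auto
    show "(\<integral>x. enn2real (n g x) \<partial>M) = enn2real (\<integral>\<^sup>+y. ennreal (g y) \<partial>(M \<bind> N))"
      using eq by (subst integral_eq_nn_integral) auto
  qed
  have "(\<integral>x. \<integral>y. f y \<partial>N x \<partial>M) = (\<integral>x. enn2real (n f x) - enn2real (n (\<lambda>y. - f y) x) \<partial>M)"
    using AE_int
    by (intro integral_cong_AE) (auto elim!: eventually_mono simp: real_lebesgue_integral_def n_def[symmetric])
  also have "\<dots> = (\<integral>y. f y \<partial>(M \<bind> N))"
    by (subst Bochner_Integration.integral_diff) (auto simp: part real_lebesgue_integral_def[OF int])
  finally show "(\<integral>y. f y \<partial>(M \<bind> N)) = (\<integral>x. \<integral>y. f y \<partial>N x \<partial>M)" ..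
qed

lemma diff_error:
  fixes a b A B T :: real
  shows "\<bar>a - A\<bar> \<le> T \<Longrightarrow> \<bar>b - B\<bar> \<le> T \<Longrightarrow> \<bar>(a - b) - (A - B)\<bar> \<le> 2 * T"
  by linarith

section \<open>The Markov chain of state-action pairs under a threshold rule\<close>

definition transition :: "project \<Rightarrow> ereal \<Rightarrow> real \<times> bool \<Rightarrow> (real \<times> bool) measure" where
  "transition P z p =
    kernel P (snd p) (fst p) \<bind> (\<lambda>y. return (state_action_space P) (y, z < ereal y))"

text \<open>The chain starts from a pair rather than a state, so that the first action is free:
  \<open>(x, a)\<close> serves \<open>action_then a\<close>, and \<open>(x, z < ereal x)\<close>
  serves the threshold policy itself.\<close>

primrec chain :: "project \<Rightarrow> ereal \<Rightarrow> nat \<Rightarrow> real \<times> bool \<Rightarrow> (real \<times> bool) measure" where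
  "chain P z 0 p = return (state_action_space P) p"
| "chain P z (Suc t) p = chain P z t p \<bind> transition P z"

lemma space_state_action_space [simp]: "space (state_action_space P) = states P \<times> UNIV"
  by (simp add: state_action_space_def space_pair_measure)

lemma threshold_action_measurable:
  "(\<lambda>y. (y, z < ereal y)) \<in> state_space P \<rightarrow>\<^sub>M state_action_space P"
proof -
  have "(\<lambda>y. z < ereal y) \<in> state_space P \<rightarrow>\<^sub>M count_space UNIV"
    unfolding state_space_def by (rule measurable_restrict_space1) measurable
  then show ?thesis
    unfolding state_action_space_def by (intro measurable_Pair) simp_all
qed

context project_model
begin

abbreviation "S \<equiv> state_action_space P"

lemma kernel_measurable_pair: "(\<lambda>p. kernel P (snd p) (fst p)) \<in> S \<rightarrow>\<^sub>M prob_algebra (state_space P)"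
  unfolding state_action_space_def
  by (rule measurable_compose_countable'[where I = UNIV and g = snd and f = "\<lambda>a p. kernel P a (fst p)"])
    (auto intro!: measurable_compose[OF measurable_fst kernel])

lemma threshold_return_measurable:
  "(\<lambda>y. return S (y, z < ereal y)) \<in> state_space P \<rightarrow>\<^sub>M prob_algebra S"
  by (rule measurable_compose[OF threshold_action_measurable measurable_return_prob_space])

lemma transition_measurable: "transition P z \<in> S \<rightarrow>\<^sub>M prob_algebra S"
  unfolding transition_def[abs_def]
  by (rule measurable_bind_prob_space[OF kernel_measurable_pair threshold_return_measurable])

lemma chain_measurable: "chain P z t \<in> S \<rightarrow>\<^sub>M prob_algebra S"
proof (induction t)
  case 0
  show ?case unfolding chain.simps(1)[abs_def] by (rule measurable_return_prob_space)
next
  case (Suc t)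
  show ?case unfolding chain.simps(2)[abs_def]
    by (rule measurable_bind_prob_space[OF Suc transition_measurable])
qed

lemma sets_chain: "p \<in> space S \<Longrightarrow> sets (chain P z t p) = sets S"
  using measurable_space[OF chain_measurable] by (simp add: space_prob_algebra)

lemma space_chain: "p \<in> space S \<Longrightarrow> space (chain P z t p) = space S"
  by (rule sets_eq_imp_space_eq[OF sets_chain])

lemma kernel_space:
  assumes "x \<in> states P"
  shows "sets (kernel P a x) = sets (state_space P)" "space (kernel P a x) = states P"
proof -
  show sets: "sets (kernel P a x) = sets (state_space P)"
    using measurable_space[OF kernel, of x a] assms by (simp add: space_prob_algebra)
  show "space (kernel P a x) = states P"
    using sets_eq_imp_space_eq[OF sets] by simp
qed

text \<open>\<open>chain\<close> adds transitions at the end, whereas the recursions for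
  \<open>f_fin\<close> and \<open>g_fin\<close> condition on the first one. Associativity of
  \<open>bind\<close> moves a transition to the front.\<close>

lemma chain_first_step:
  assumes p: "p \<in> space S"
  shows "chain P z (Suc t) p =
    kernel P (snd p) (fst p) \<bind> (\<lambda>y. chain P z t (y, z < ereal y))"
proof -
  note trans = measurable_prob_algebraD[OF transition_measurable]
    and chain = measurable_prob_algebraD[OF chain_measurable]
  have trans_p: "transition P z p \<in> space (prob_algebra S)"
    using measurable_space[OF transition_measurable p] .
  then have sets: "sets (transition P z p) = sets S"
    by (simp add: space_prob_algebra)
  have "chain P z (Suc t) p = transition P z p \<bind> chain P z t"
  proof (induction t)
    case 0
    have "chain P z (Suc 0) p = transition P z p"
      using p by (simp add: bind_return[OF trans])
    also have "\<dots> = transition P z p \<bind> chain P z 0"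
      unfolding chain.simps(1)[abs_def] by (rule bind_return''[symmetric]) (rule sets)
    finally show ?case .
  next
    case (Suc t)
    have "chain P z (Suc (Suc t)) p = (transition P z p \<bind> chain P z t) \<bind> transition P z"
      unfolding chain.simps(2)[of P z "Suc t" p] Suc ..
    also have "\<dots> = transition P z p \<bind> (\<lambda>q. chain P z t q \<bind> transition P z)"
      by (rule bind_assoc[OF _ trans]) (simp add: chain measurable_cong_sets[OF sets])
    finally show ?case by simp
  qed
  also have "\<dots> = kernel P (snd p) (fst p) \<bind> (\<lambda>y. return S (y, z < ereal y) \<bind> chain P z t)"
    unfolding transition_def
    by (rule bind_assoc[OF _ chain])
      (use p in \<open>auto simp: measurable_cong_sets[OF kernel_space(1)]
        intro: measurable_prob_algebraD[OF threshold_return_measurable]\<close>)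
  also have "\<dots> = kernel P (snd p) (fst p) \<bind> (\<lambda>y. chain P z t (y, z < ereal y))"
    using p by (intro bind_cong bind_return[OF chain]) (auto simp: kernel_space)
  finally show ?thesis .
qed

section \<open>Identification of the marginals of the process law with the chain\<close>

lemma sets_law:
  assumes "nonanticipative P \<pi>" "x \<in> states P"
  shows "sets (law P \<pi> x) = sets (PiM UNIV (\<lambda>_. S))"
proof -
  interpret Ionescu_Tulcea "step P \<pi> x" "\<lambda>_. S"
    by (rule Ionescu_Tulcea_step[OF assms])
  show ?thesis unfolding law_def by (rule PF.sets_lim)
qed

text \<open>Induction on time. The assumptions on \<open>\<pi>\<close> fix the first action and make
  every later action a function of the current state, so each later step depends on the history only
  through its last pair.\<close>

lemma distr_law_chain:
  assumes \<pi>: "nonanticipative P \<pi>" and x: "x \<in> states P"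
    and \<pi>_0: "\<And>h. \<pi> 0 h x = return (count_space UNIV) a"
    and \<pi>_Suc: "\<And>t h y. \<pi> (Suc t) h y = return (count_space UNIV) (z < ereal y)"
  shows "distr (law P \<pi> x) S (\<lambda>\<omega>. \<omega> t) = chain P z t (x, a)"
proof -
  interpret Ionescu_Tulcea "step P \<pi> x" "\<lambda>_. S"
    by (rule Ionescu_Tulcea_step[OF \<pi> x])
  have Pair: "Pair y \<in> count_space UNIV \<rightarrow>\<^sub>M S" if "y \<in> states P" for y
    using that by simp
  show ?thesis
  proof (induction t)
    case 0
    \<comment> \<open>The product over no indices has the everywhere undefined function as its only
      point; it is the empty history at time 0.\<close>
    let ?u = "\<lambda>_ :: nat. undefined :: real \<times> bool"
    have "step P \<pi> x 0 ?u = return S (x, a)"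
    proof -
      have "(\<lambda>y. distr (\<pi> 0 ?u y) S (Pair y)) \<in> state_space P \<rightarrow>\<^sub>M subprob_algebra S"
      proof (rule measurable_prob_algebraD, rule measurable_distr_prob_space2[where M = "count_space UNIV"])
        have 1: "(\<lambda>(h, x). \<pi> 0 h x) \<in> PiM {0..<0} (\<lambda>_. S) \<Otimes>\<^sub>M state_space P
            \<rightarrow>\<^sub>M prob_algebra (count_space UNIV)"
          using \<pi> unfolding nonanticipative_def by blast
        have 2: "(\<lambda>y. (?u, y)) \<in> state_space P \<rightarrow>\<^sub>M PiM {0..<0::nat} (\<lambda>_. S) \<Otimes>\<^sub>M state_space P"
          by (intro measurable_Pair measurable_const) (simp_all add: space_PiM)
        show "\<pi> 0 ?u \<in> state_space P \<rightarrow>\<^sub>M prob_algebra (count_space UNIV)"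
          using measurable_compose[OF 2 1] by simp
        show "(\<lambda>(y, b). (y, b)) \<in> state_space P \<Otimes>\<^sub>M count_space UNIV \<rightarrow>\<^sub>M S"
          unfolding state_action_space_def by simp
      qed
      then have "step P \<pi> x 0 ?u = distr (\<pi> 0 ?u x) S (Pair x)"
        unfolding step_def using x by (simp add: bind_return)
      also have "\<dots> = return S (x, a)"
        unfolding \<pi>_0 by (rule distr_return[OF Pair[OF x]]) simp
      finally show ?thesis .
    qed
    then show ?case
      unfolding law_def distr_lim_component using x
      using bind_return[OF P[of 0], of "\<lambda>_. undefined"] by (simp add: space_PiM)
  next
    case (Suc t)
    have "distr (law P \<pi> x) S (\<lambda>\<omega>. \<omega> (Suc t)) = distr (law P \<pi> x) S (\<lambda>\<omega>. \<omega> t) \<bind> transition P z"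
      unfolding law_def
    proof (rule distr_lim_component_Suc[OF measurable_prob_algebraD[OF transition_measurable]])
      fix h assume "h \<in> space (PiM {0..<Suc t} (\<lambda>_. S))"
      then have "h t \<in> space S" unfolding space_PiM by (rule PiE_mem) simp
      then show "step P \<pi> x (Suc t) h = transition P z (h t)"
        unfolding step_def transition_def
        by (auto simp: \<pi>_Suc distr_return[OF Pair] kernel_space intro!: bind_cong)
    qed
    then show ?case by (simp add: Suc)
  qed
qed

lemma distr_law_threshold:
  "x \<in> states P \<Longrightarrow> distr (law P (threshold_policy z) x) S (\<lambda>\<omega>. \<omega> t) = chain P z t (x, z < ereal x)"
  by (rule distr_law_chain[OF nonanticipative_threshold_policy]) (simp_all add: threshold_policy_def)

lemma distr_law_action_then:
  "x \<in> states P \<Longrightarrow>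
    distr (law P (action_then a (threshold_policy z)) x) S (\<lambda>\<omega>. \<omega> t) = chain P z t (x, a)"
  by (rule distr_law_chain[OF nonanticipative_action_then[OF nonanticipative_threshold_policy]])
    (simp_all add: threshold_policy_def action_then_def)

section \<open>Discounted weight bounds along the chain\<close>

lemma \<gamma>_nonneg: "0 \<le> \<gamma>"
  using disc \<gamma> by simp

lemma weight_measurable_pair: "(\<lambda>q. w (fst q)) \<in> borel_measurable S"
  unfolding state_action_space_def by (rule measurable_compose[OF measurable_fst weight_measurable])

text \<open>Iteration of the drift condition, one discount factor per transition. The product is
  kept in \<open>ennreal\<close> because the integral of \<open>w\<close> may be infinite when
  \<open>disc P = 0\<close>.\<close>

lemma weight_chain:
  assumes p: "p \<in> space S"
  shows "ennreal (disc P ^ t) * (\<integral>\<^sup>+q. ennreal (w (fst q)) \<partial>chain P z t p)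
    \<le> ennreal (\<gamma> ^ t * w (fst p))"
proof (induction t)
  case 0
  show ?case
    using p weight_measurable_pair by (simp add: nn_integral_return)
next
  case (Suc t)
  note trans = measurable_prob_algebraD[OF transition_measurable]
  have w_meas[measurable]: "(\<lambda>q. ennreal (w (fst q))) \<in> borel_measurable S"
    using weight_measurable_pair by simp
  have step: "ennreal (disc P) * (\<integral>\<^sup>+q'. ennreal (w (fst q')) \<partial>transition P z q)
      \<le> ennreal (\<gamma> * w (fst q))" if q: "q \<in> space S" for q
  proof -
    have "(\<integral>\<^sup>+q'. ennreal (w (fst q')) \<partial>transition P z q)
        = (\<integral>\<^sup>+y. (\<integral>\<^sup>+q'. ennreal (w (fst q')) \<partial>return S (y, z < ereal y)) \<partial>kernel P (snd q) (fst q))"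
      unfolding transition_def using q
      by (intro nn_integral_bind[OF w_meas])
        (auto simp: measurable_cong_sets[OF kernel_space(1)]
          intro: measurable_prob_algebraD[OF threshold_return_measurable])
    also have "\<dots> = (\<integral>\<^sup>+y. ennreal (w y) \<partial>kernel P (snd q) (fst q))"
      using q by (intro nn_integral_cong) (auto simp: nn_integral_return kernel_space)
    finally show ?thesis using weight_drift[of "fst q" "snd q"] q by auto
  qed
  have inner[measurable]: "(\<lambda>q. \<integral>\<^sup>+q'. ennreal (w (fst q')) \<partial>transition P z q) \<in> borel_measurable S"
    using trans by measurable
  have cong: "borel_measurable (chain P z t p) = borel_measurable S"
    by (rule measurable_cong_sets[OF sets_chain[OF p] refl])
  \<comment> \<open>One factor \<open>disc P\<close> is set aside for the last transition, where
    \<open>step\<close> applies; the other \<open>t\<close> factors remain for the induction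
    hypothesis.\<close>
  have "ennreal (disc P ^ Suc t) * (\<integral>\<^sup>+q. ennreal (w (fst q)) \<partial>chain P z (Suc t) p)
      = ennreal (disc P ^ t) * (ennreal (disc P) *
          (\<integral>\<^sup>+q. (\<integral>\<^sup>+q'. ennreal (w (fst q')) \<partial>transition P z q) \<partial>chain P z t p))"
    using disc trans
    by (simp add: nn_integral_bind[OF w_meas] measurable_cong_sets[OF sets_chain[OF p] refl]
        ennreal_mult mult_ac)
  also have "\<dots> = ennreal (disc P ^ t) *
      (\<integral>\<^sup>+q. ennreal (disc P) * (\<integral>\<^sup>+q'. ennreal (w (fst q')) \<partial>transition P z q) \<partial>chain P z t p)"
    using inner by (subst nn_integral_cmult) (simp_all add: cong)
  also have "\<dots> \<le> ennreal (disc P ^ t) * (\<integral>\<^sup>+q. ennreal \<gamma> * ennreal (w (fst q)) \<partial>chain P z t p)"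
  proof (intro mult_left_mono nn_integral_mono)
    fix q assume "q \<in> space (chain P z t p)"
    then show "ennreal (disc P) * (\<integral>\<^sup>+q'. ennreal (w (fst q')) \<partial>transition P z q)
        \<le> ennreal \<gamma> * ennreal (w (fst q))"
      using step[of q] \<gamma>_nonneg by (simp only: space_chain[OF p] ennreal_mult'[symmetric])
  qed simp
  also have "\<dots> = ennreal \<gamma> * (ennreal (disc P ^ t) * (\<integral>\<^sup>+q. ennreal (w (fst q)) \<partial>chain P z t p))"
    using w_meas by (subst nn_integral_cmult) (simp_all add: cong mult_ac)
  also have "\<dots> \<le> ennreal \<gamma> * ennreal (\<gamma> ^ t * w (fst p))"
    by (intro mult_left_mono Suc) simp
  also have "\<dots> = ennreal (\<gamma> ^ Suc t * w (fst p))"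
    using \<gamma>_nonneg by (simp add: ennreal_mult' mult_ac)
  finally show ?case .
qed

section \<open>Discounted stage values of a common \<open>\<rho>\<close>, later
  \<open>reward P\<close> and \<open>resource P\<close>\<close>

context
  fixes \<rho> :: "real \<Rightarrow> bool \<Rightarrow> real"
  assumes \<rho>_cont: "\<And>a. continuous_on (states P) (\<lambda>x. \<rho> x a)"
    and \<rho>_bound: "\<forall>x\<in>states P. \<forall>a. \<bar>\<rho> x a\<bar> \<le> M * w x"
begin

text \<open>
  The discount factor stays inside the integral: for \<open>disc P = 0\<close> the weight need not be integrable
  under the transition kernels, but the discounted reward is.
\<close>

definition stage :: "ereal \<Rightarrow> nat \<Rightarrow> real \<times> bool \<Rightarrow> real" where
  "stage z t p = (\<integral>q. disc P ^ t * \<rho> (fst q) (snd q) \<partial>chain P z t p)"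

lemma \<rho>_measurable: "(\<lambda>q. \<rho> (fst q) (snd q)) \<in> borel_measurable S"
  unfolding state_action_space_def
proof (rule measurable_compose_countable'[where I = UNIV and g = snd and f = "\<lambda>a p. \<rho> (fst p) a"])
  fix a
  have "(\<lambda>x. \<rho> x a) \<in> borel_measurable (state_space P)"
    unfolding state_space_def by (rule borel_measurable_continuous_on_restrict[OF \<rho>_cont])
  then show "(\<lambda>p. \<rho> (fst p) a) \<in> borel_measurable (state_space P \<Otimes>\<^sub>M count_space UNIV)"
    by (rule measurable_compose[OF measurable_fst])
qed simp_all

lemma nn_stage_bound:
  assumes p: "p \<in> space S"
  shows "(\<integral>\<^sup>+q. ennreal \<bar>disc P ^ t * \<rho> (fst q) (snd q)\<bar> \<partial>chain P z t p)
    \<le> ennreal (M * \<gamma> ^ t * w (fst p))"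
proof -
  have cong: "borel_measurable (chain P z t p) = borel_measurable S"
    by (rule measurable_cong_sets[OF sets_chain[OF p] refl])
  have "(\<integral>\<^sup>+q. ennreal \<bar>disc P ^ t * \<rho> (fst q) (snd q)\<bar> \<partial>chain P z t p)
      \<le> (\<integral>\<^sup>+q. ennreal M * (ennreal (disc P ^ t) * ennreal (w (fst q))) \<partial>chain P z t p)"
  proof (rule nn_integral_mono)
    fix q assume "q \<in> space (chain P z t p)"
    then have "\<bar>\<rho> (fst q) (snd q)\<bar> \<le> M * w (fst q)"
      using p \<rho>_bound by (auto simp: space_chain)
    from mult_left_mono[OF this, of "disc P ^ t"]
    have "\<bar>disc P ^ t * \<rho> (fst q) (snd q)\<bar> \<le> M * (disc P ^ t * w (fst q))"
      using disc by (simp add: abs_mult mult_ac)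
    then show "ennreal \<bar>disc P ^ t * \<rho> (fst q) (snd q)\<bar>
        \<le> ennreal M * (ennreal (disc P ^ t) * ennreal (w (fst q)))"
      using disc M_pos by (simp add: ennreal_mult'[symmetric] ennreal_leI)
  qed
  also have "\<dots> = ennreal M * (ennreal (disc P ^ t) * (\<integral>\<^sup>+q. ennreal (w (fst q)) \<partial>chain P z t p))"
    using weight_measurable_pair by (simp add: nn_integral_cmult cong)
  also have "\<dots> \<le> ennreal M * ennreal (\<gamma> ^ t * w (fst p))"
    by (intro mult_left_mono weight_chain p) simp
  also have "\<dots> = ennreal (M * \<gamma> ^ t * w (fst p))"
    using M_pos by (simp add: ennreal_mult'[symmetric] mult_ac)
  finally show ?thesis .
qed

lemma integrable_stage:
  assumes p: "p \<in> space S"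
  shows "integrable (chain P z t p) (\<lambda>q. disc P ^ t * \<rho> (fst q) (snd q))"
proof (rule integrableI_bounded)
  show "(\<lambda>q. disc P ^ t * \<rho> (fst q) (snd q)) \<in> borel_measurable (chain P z t p)"
    using \<rho>_measurable by (simp add: measurable_cong_sets[OF sets_chain[OF p] refl])
  show "(\<integral>\<^sup>+q. ennreal (norm (disc P ^ t * \<rho> (fst q) (snd q))) \<partial>chain P z t p) < \<infinity>"
    using le_less_trans[OF nn_stage_bound[OF p]] by simp
qed

lemma stage_bound:
  assumes p: "p \<in> space S"
  shows "\<bar>stage z t p\<bar> \<le> M * \<gamma> ^ t * w (fst p)"
proof -
  have "ennreal \<bar>stage z t p\<bar> \<le> (\<integral>\<^sup>+q. ennreal \<bar>disc P ^ t * \<rho> (fst q) (snd q)\<bar> \<partial>chain P z t p)"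
    unfolding stage_def using integral_norm_bound_ennreal[OF integrable_stage[OF p]] by simp
  also note nn_stage_bound[OF p]
  finally show ?thesis
    using M_pos \<gamma>_nonneg weight_ge_1[of "fst p"] p by (subst (asm) ennreal_le_iff) auto
qed

lemma stage_0: "p \<in> space S \<Longrightarrow> stage z 0 p = \<rho> (fst p) (snd p)"
  using \<rho>_measurable by (simp add: stage_def integral_return)

text \<open>Conditioning on the first transition, with \<open>disc P ^ Suc t\<close> split into
  \<open>disc P\<close> and \<open>disc P ^ t\<close>. Integrability is claimed with the factor
  \<open>disc P\<close> inside: if it is 0, \<open>stage z 0\<close> alone need not be integrable
  under the kernel.\<close>

lemma stage_Suc:
  assumes x: "x \<in> states P"
  shows "integrable (kernel P a x) (\<lambda>y. disc P * stage z t (y, z < ereal y))"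
    and "stage z (Suc t) (x, a) = disc P * (\<integral>y. stage z t (y, z < ereal y) \<partial>kernel P a x)"
proof -
  have p: "(x, a) \<in> space S" using x by simp
  let ?N = "\<lambda>y. chain P z t (y, z < ereal y)" and ?f = "\<lambda>q. disc P ^ Suc t * \<rho> (fst q) (snd q)"
  have N: "?N \<in> kernel P a x \<rightarrow>\<^sub>M subprob_algebra S"
    unfolding measurable_cong_sets[OF kernel_space(1)[OF x] refl]
    by (intro measurable_prob_algebraD measurable_compose[OF threshold_action_measurable chain_measurable])
  have f: "?f \<in> borel_measurable S" using \<rho>_measurable by simp
  have eq: "chain P z (Suc t) (x, a) = kernel P a x \<bind> ?N"
    using chain_first_step[OF p] by simp
  have int: "integrable (kernel P a x \<bind> ?N) ?f"
    using integrable_stage[OF p, of z "Suc t"] unfolding eq .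
  have inner: "(\<integral>q. ?f q \<partial>?N y) = disc P * stage z t (y, z < ereal y)" for y
    by (simp add: stage_def mult.assoc)
  show "integrable (kernel P a x) (\<lambda>y. disc P * stage z t (y, z < ereal y))"
    using integrable_bind_inner[OF N int f] unfolding inner .
  show "stage z (Suc t) (x, a) = disc P * (\<integral>y. stage z t (y, z < ereal y) \<partial>kernel P a x)"
    using integral_bind_integrable[OF N int f] unfolding inner stage_def[of z "Suc t"] eq by simp
qed

text \<open>Each term involves one coordinate, so the marginals determine its integral. The expected
  absolute terms are dominated by a geometric series, which yields almost sure absolute summability
  and lets expectation and infinite sum be exchanged.\<close>

lemma
  assumes \<pi>: "sets (law P \<pi> x) = sets (PiM UNIV (\<lambda>_. S))"
    and marginal: "\<And>t. distr (law P \<pi> x) S (\<lambda>\<omega>. \<omega> t) = chain P z t (x, a)"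
    and x: "x \<in> states P"
  shows integrable_law_stage: "integrable (law P \<pi> x) (\<lambda>\<omega>. disc P ^ t * \<rho> (fst (\<omega> t)) (snd (\<omega> t)))"
    and integral_law_stage:
      "(\<integral>\<omega>. disc P ^ t * \<rho> (fst (\<omega> t)) (snd (\<omega> t)) \<partial>law P \<pi> x) = stage z t (x, a)"
    and law_stage_sums: "(\<lambda>t. stage z t (x, a)) sums
      (\<integral>\<omega>. (\<Sum>t. disc P ^ t * \<rho> (fst (\<omega> t)) (snd (\<omega> t))) \<partial>law P \<pi> x)"
proof -
  have p: "(x, a) \<in> space S" using x by simp
  have comp: "(\<lambda>\<omega>. \<omega> t) \<in> law P \<pi> x \<rightarrow>\<^sub>M S" for t
    unfolding measurable_cong_sets[OF \<pi> refl] by (rule measurable_component_singleton) simp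
  have f: "(\<lambda>q. disc P ^ t * \<rho> (fst q) (snd q)) \<in> borel_measurable S" for t
    using \<rho>_measurable by simp
  show int: "integrable (law P \<pi> x) (\<lambda>\<omega>. disc P ^ t * \<rho> (fst (\<omega> t)) (snd (\<omega> t)))" for t
    using integrable_stage[OF p, of z t]
    unfolding marginal[symmetric] integrable_distr_eq[OF comp f] .
  show eq: "(\<integral>\<omega>. disc P ^ t * \<rho> (fst (\<omega> t)) (snd (\<omega> t)) \<partial>law P \<pi> x) = stage z t (x, a)" for t
    unfolding stage_def marginal[symmetric] integral_distr[OF comp f] ..
  have nn: "(\<integral>\<^sup>+\<omega>. ennreal \<bar>disc P ^ t * \<rho> (fst (\<omega> t)) (snd (\<omega> t))\<bar> \<partial>law P \<pi> x)
      \<le> ennreal (M * \<gamma> ^ t * w x)" for t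
  proof -
    have "(\<lambda>q. ennreal \<bar>disc P ^ t * \<rho> (fst q) (snd q)\<bar>)
        \<in> borel_measurable (distr (law P \<pi> x) S (\<lambda>\<omega>. \<omega> t))"
      using f[of t] by simp
    from nn_integral_distr[OF comp this]
    show ?thesis using nn_stage_bound[OF p, where z = z and t = t] by (simp only: marginal fst_conv)
  qed
  have summable_bound: "summable (\<lambda>t. M * \<gamma> ^ t * w x)"
    using \<gamma>_nonneg \<gamma>(2) by (intro summable_mult summable_mult2 summable_geometric) simp
  have bound_nonneg: "0 \<le> M * \<gamma> ^ t * w x" for t
    using M_pos \<gamma>_nonneg weight_ge_1[OF x] by simp
  have meas: "(\<lambda>\<omega>. ennreal \<bar>disc P ^ t * \<rho> (fst (\<omega> t)) (snd (\<omega> t))\<bar>) \<in> borel_measurable (law P \<pi> x)" for t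
    using borel_measurable_integrable[OF int[of t]] by simp
  \<comment> \<open>Monotone convergence bounds the expected sum of absolute values, so that sum is
    finite almost everywhere.\<close>
  have "(\<integral>\<^sup>+\<omega>. (\<Sum>t. ennreal \<bar>disc P ^ t * \<rho> (fst (\<omega> t)) (snd (\<omega> t))\<bar>) \<partial>law P \<pi> x)
      = (\<Sum>t. \<integral>\<^sup>+\<omega>. ennreal \<bar>disc P ^ t * \<rho> (fst (\<omega> t)) (snd (\<omega> t))\<bar> \<partial>law P \<pi> x)"
    by (rule nn_integral_suminf[OF meas])
  also have "\<dots> \<le> (\<Sum>t. ennreal (M * \<gamma> ^ t * w x))"
    by (intro suminf_le nn) simp_all
  also have "\<dots> < \<infinity>"
    using ennreal_suminf_neq_top[OF summable_bound bound_nonneg] by (simp add: less_top)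
  finally have "AE \<omega> in law P \<pi> x. (\<Sum>t. ennreal \<bar>disc P ^ t * \<rho> (fst (\<omega> t)) (snd (\<omega> t))\<bar>) \<noteq> \<infinity>"
    using meas by (intro nn_integral_PInf_AE) simp_all
  then have AE: "AE \<omega> in law P \<pi> x. summable (\<lambda>t. norm (disc P ^ t * \<rho> (fst (\<omega> t)) (snd (\<omega> t))))"
    by eventually_elim (auto intro!: summable_suminf_not_top)
  have "summable (\<lambda>t. \<integral>\<omega>. norm (disc P ^ t * \<rho> (fst (\<omega> t)) (snd (\<omega> t))) \<partial>law P \<pi> x)"
  proof (rule summable_comparison_test'[OF summable_bound])
    fix t
    have "ennreal (\<integral>\<omega>. norm (disc P ^ t * \<rho> (fst (\<omega> t)) (snd (\<omega> t))) \<partial>law P \<pi> x)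
        \<le> ennreal (M * \<gamma> ^ t * w x)"
      using nn[of t] int[of t] by (subst nn_integral_eq_integral[symmetric]) auto
    then show "norm (\<integral>\<omega>. norm (disc P ^ t * \<rho> (fst (\<omega> t)) (snd (\<omega> t))) \<partial>law P \<pi> x)
        \<le> M * \<gamma> ^ t * w x"
      using bound_nonneg[of t] by simp
  qed
  from sums_integral[OF int AE this]
  show "(\<lambda>t. stage z t (x, a)) sums
      (\<integral>\<omega>. (\<Sum>t. disc P ^ t * \<rho> (fst (\<omega> t)) (snd (\<omega> t))) \<partial>law P \<pi> x)"
    unfolding eq .
qed

text \<open>This matches the recursions of \<open>f_fin\<close> and \<open>g_fin\<close>: the term
  at time 0 is split off, and the others are shifted by \<open>stage_Suc\<close>.\<close>

lemma stage_partial_sum_recursion: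
  assumes x: "x \<in> states P"
  shows "(\<Sum>t\<le>Suc k. stage z t (x, a)) = \<rho> x a + disc P * (\<integral>y. (\<integral>\<omega>.
    (\<Sum>t\<le>k. disc P ^ t * \<rho> (fst (\<omega> t)) (snd (\<omega> t))) \<partial>law P (threshold_policy z) y) \<partial>kernel P a x)"
proof -
  have fin: "(\<integral>\<omega>. (\<Sum>t\<le>k. disc P ^ t * \<rho> (fst (\<omega> t)) (snd (\<omega> t))) \<partial>law P (threshold_policy z) y)
      = (\<Sum>t\<le>k. stage z t (y, z < ereal y))" if y: "y \<in> states P" for y
  proof -
    note * = sets_law[OF nonanticipative_threshold_policy y] distr_law_threshold[OF y] y
    show ?thesis
      by (simp only: Bochner_Integration.integral_sum integral_law_stage[OF *] integrable_law_stage[OF *])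
  qed
  have "(\<Sum>t\<le>Suc k. stage z t (x, a)) = \<rho> x a + (\<Sum>t\<le>k. stage z (Suc t) (x, a))"
    using x by (simp only: sum.atMost_Suc_shift) (simp add: stage_0)
  \<comment> \<open>The discount factor goes inside each integral before sum and integral are
    exchanged, as integrability is known only for the discounted stages; it comes out again
    afterwards.\<close>
  also have "(\<Sum>t\<le>k. stage z (Suc t) (x, a))
      = (\<Sum>t\<le>k. \<integral>y. disc P * stage z t (y, z < ereal y) \<partial>kernel P a x)"
    by (simp add: stage_Suc(2)[OF x])
  also have "\<dots> = (\<integral>y. (\<Sum>t\<le>k. disc P * stage z t (y, z < ereal y)) \<partial>kernel P a x)"
    by (rule Bochner_Integration.integral_sum[symmetric]) (rule stage_Suc(1)[OF x])
  also have "\<dots> = disc P * (\<integral>y. (\<Sum>t\<le>k. stage z t (y, z < ereal y)) \<partial>kernel P a x)"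
    by (simp add: sum_distrib_left[symmetric])
  also have "(\<integral>y. (\<Sum>t\<le>k. stage z t (y, z < ereal y)) \<partial>kernel P a x)
      = (\<integral>y. (\<integral>\<omega>. (\<Sum>t\<le>k. disc P ^ t * \<rho> (fst (\<omega> t)) (snd (\<omega> t)))
          \<partial>law P (threshold_policy z) y) \<partial>kernel P a x)"
    using x by (intro Bochner_Integration.integral_cong) (simp_all add: fin kernel_space)
  finally show ?thesis .
qed

text \<open>The partial sum and the infinite-horizon value belong to the same series. Terms up to
  \<open>k\<close> are removed, so the dominating geometric tail starts at exponent
  \<open>Suc k\<close>.\<close>

lemma stage_tail:
  assumes x: "x \<in> states P"
  shows "\<bar>(\<Sum>t\<le>k. stage z t (x, a)) - (\<integral>\<omega>. (\<Sum>t. disc P ^ t * \<rho> (fst (\<omega> t)) (snd (\<omega> t)))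
    \<partial>law P (action_then a (threshold_policy z)) x)\<bar> \<le> M / (1 - \<gamma>) * \<gamma> ^ Suc k * w x"
proof -
  note na = nonanticipative_action_then[OF nonanticipative_threshold_policy]
  note sums = law_stage_sums[OF sets_law[OF na x] distr_law_action_then[OF x, of a z] x]
  have geom: "(\<lambda>t. M * \<gamma> ^ (t + Suc k) * w x) sums (M / (1 - \<gamma>) * \<gamma> ^ Suc k * w x)"
  proof -
    have "(\<lambda>t. \<gamma> ^ t) sums (1 / (1 - \<gamma>))"
      using \<gamma>_nonneg \<gamma>(2) by (intro geometric_sums) simp
    from sums_mult[OF this, of "M * \<gamma> ^ Suc k * w x"] show ?thesis
      by (simp add: power_add mult_ac)
  qed
  have tail: "(\<lambda>t. stage z (t + Suc k) (x, a)) sums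
      ((\<integral>\<omega>. (\<Sum>t. disc P ^ t * \<rho> (fst (\<omega> t)) (snd (\<omega> t)))
        \<partial>law P (action_then a (threshold_policy z)) x) - (\<Sum>t\<le>k. stage z t (x, a)))"
    using sums_split_initial_segment[OF sums, where n = "Suc k"] by (simp only: lessThan_Suc_atMost)
  have le: "\<bar>stage z (t + Suc k) (x, a)\<bar> \<le> M * \<gamma> ^ (t + Suc k) * w x" for t
    using stage_bound[of "(x, a)" z "t + Suc k"] x by simp
  have "norm (\<Sum>t. stage z (t + Suc k) (x, a)) \<le> (\<Sum>t. M * \<gamma> ^ (t + Suc k) * w x)"
    using le geom by (intro norm_suminf_le) (auto simp: sums_iff)
  then show ?thesis
    using tail geom by (simp add: sums_iff abs_minus_commute)
qed

end

section \<open>Errors of the finite-horizon metrics and of their quotient\<close>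

lemma reward_bound: "\<forall>x\<in>states P. \<forall>a. \<bar>reward P x a\<bar> \<le> M * w x"
  using weight_bound by simp

text \<open>\<open>weight_bound\<close> limits the resource only from above; nonnegativity comes
  from \<open>resource_order\<close>, for the active action by way of the passive one.\<close>

lemma resource_bound: "\<forall>x\<in>states P. \<forall>a. \<bar>resource P x a\<bar> \<le> M * w x"
proof (intro ballI allI)
  fix x a assume x: "x \<in> states P"
  then have "0 \<le> resource P x a" using resource_order[of x] by (cases a) auto
  then show "\<bar>resource P x a\<bar> \<le> M * w x" using weight_bound[OF x, of a] by simp
qed

lemma f_fin_error:
  assumes x: "x \<in> states P"
  shows "\<bar>f_fin P k x z - f_metric P x z\<bar> \<le> 2 * (M / (1 - \<gamma>)) * \<gamma> ^ Suc k * w x"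
proof -
  let ?s = "\<lambda>a. \<Sum>t\<le>k. stage (reward P) z t (x, a)"
  \<comment> \<open>The indices agree: \<open>f_fin\<close> at \<open>Suc j\<close> adds to the
    initial stage the \<open>j + 1\<close> stages of \<open>F_fin P j\<close>, which gives the times
    up to \<open>Suc j\<close>.\<close>
  have "f_fin P k x z = ?s True - ?s False"
  proof (cases k)
    case 0
    then show ?thesis using x by (simp add: stage_0[OF reward_cont reward_bound])
  next
    case (Suc j)
    show ?thesis
      unfolding Suc stage_partial_sum_recursion[OF reward_cont reward_bound x] by (simp add: F_fin_def)
  qed
  then have "\<bar>f_fin P k x z - f_metric P x z\<bar> \<le> 2 * (M / (1 - \<gamma>) * \<gamma> ^ Suc k * w x)"
    unfolding f_metric_def F_metric_def by (simp only:) (intro diff_error stage_tail reward_cont reward_bound x)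
  then show ?thesis by (simp only: mult.assoc)
qed

lemma g_fin_error:
  assumes x: "x \<in> states P"
  shows "\<bar>g_fin P k x z - g_metric P x z\<bar> \<le> 2 * (M / (1 - \<gamma>)) * \<gamma> ^ Suc k * w x"
proof -
  let ?s = "\<lambda>a. \<Sum>t\<le>k. stage (resource P) z t (x, a)"
  have "g_fin P k x z = ?s True - ?s False"
  proof (cases k)
    case 0
    then show ?thesis using x by (simp add: stage_0[OF resource_cont resource_bound])
  next
    case (Suc j)
    show ?thesis
      unfolding Suc stage_partial_sum_recursion[OF resource_cont resource_bound x] by (simp add: G_fin_def)
  qed
  then have "\<bar>g_fin P k x z - g_metric P x z\<bar> \<le> 2 * (M / (1 - \<gamma>) * \<gamma> ^ Suc k * w x)"
    unfolding g_metric_def G_metric_def by (simp only:) (intro diff_error stage_tail resource_cont resource_bound x)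
  then show ?thesis by (simp only: mult.assoc)
qed

lemma g_fin_tendsto:
  assumes x: "x \<in> states P"
  shows "(\<lambda>k. g_fin P k x z) \<longlonglongrightarrow> g_metric P x z"
proof -
  have "(\<lambda>k. 2 * (M / (1 - \<gamma>)) * \<gamma> ^ Suc k * w x) \<longlonglongrightarrow> 2 * (M / (1 - \<gamma>)) * 0 * w x"
    using disc \<gamma> by (intro tendsto_mult tendsto_const LIMSEQ_Suc[OF LIMSEQ_realpow_zero]) auto
  then have "(\<lambda>k. 2 * (M / (1 - \<gamma>)) * \<gamma> ^ Suc k * w x) \<longlonglongrightarrow> 0"
    by (simp only: mult_zero_left mult_zero_right)
  then have "(\<lambda>k. g_fin P k x z - g_metric P x z) \<longlonglongrightarrow> 0"
    by (rule Lim_null_comparison[rotated])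
      (simp only: real_norm_def, rule always_eventually, rule allI, rule g_fin_error[OF x])
  then show ?thesis
    by (simp add: LIM_zero_iff)
qed

text \<open>Convergence supplies the lower bound without which a real infimum has no meaning; the
  infimum then also bounds the limit.\<close>

lemma
  assumes x: "x \<in> states P"
  shows g_inf_le_g_fin: "g_inf P x z \<le> g_fin P k x z"
    and g_inf_le_g_metric: "g_inf P x z \<le> g_metric P x z"
proof -
  have "Bseq (\<lambda>k. g_fin P k x z)"
    using g_fin_tendsto[OF x] by (intro convergent_imp_Bseq) (auto simp: convergent_def)
  then have bdd: "bdd_below (range (\<lambda>k. g_fin P k x z))"
    by (intro bounded_imp_bdd_below) (simp only: Bseq_eq_bounded)
  show le: "g_inf P x z \<le> g_fin P k x z" for k
    unfolding g_inf_def by (rule cINF_lower[OF bdd]) simp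
  show "g_inf P x z \<le> g_metric P x z"
    by (rule LIMSEQ_le_const[OF g_fin_tendsto[OF x]]) (use le in blast)
qed

lemma m_fin_error:
  assumes x: "x \<in> states P" and pos: "0 < g_inf P x z"
  shows "\<bar>m_fin P k x z - m_metric P x z\<bar>
    \<le> 2 * (M / (1 - \<gamma>)) * \<gamma> ^ k * w x * (1 + \<bar>m_metric P x z\<bar>) / g_inf P x z"
proof -
  let ?f = "f_metric P x z" and ?g = "g_metric P x z" and ?fk = "f_fin P k x z" and ?gk = "g_fin P k x z"
    and ?m = "m_metric P x z"
  let ?B = "2 * (M / (1 - \<gamma>)) * \<gamma> ^ k * w x"
  have g: "0 < ?g" and gk: "g_inf P x z \<le> ?gk"
    using g_inf_le_g_metric[OF x, of z] g_inf_le_g_fin[OF x, of z k] pos by simp_all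
  \<comment> \<open>The tails give the sharper exponent \<open>Suc k\<close>; since
    \<open>\<gamma>\<close> lies between 0 and 1, it is relaxed to \<open>k\<close>.\<close>
  have \<gamma>_pow: "\<gamma> ^ Suc k \<le> \<gamma> ^ k"
    using disc \<gamma> by (intro power_decreasing) auto
  have C: "0 \<le> 2 * (M / (1 - \<gamma>))" "0 \<le> w x"
    using M_pos \<gamma> weight_ge_1[OF x] by auto
  have B: "2 * (M / (1 - \<gamma>)) * \<gamma> ^ Suc k * w x \<le> ?B"
    by (intro mult_right_mono mult_left_mono \<gamma>_pow C)
  \<comment> \<open>Positivity of \<open>?g\<close> makes \<open>m_metric\<close> a genuine quotient
    rather than the default value 0 of division by zero.\<close>
  have "?m * ?g = ?f" using g by (simp add: m_metric_def)
  then have "m_fin P k x z - ?m = ((?fk - ?f) - ?m * (?gk - ?g)) / ?gk"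
    using gk pos by (simp add: m_fin_def field_simps)
  then have "\<bar>m_fin P k x z - ?m\<bar> = \<bar>(?fk - ?f) - ?m * (?gk - ?g)\<bar> / ?gk"
    using gk pos by (simp add: abs_divide)
  also have "\<dots> \<le> (?B * (1 + \<bar>?m\<bar>)) / ?gk"
  proof (rule divide_right_mono)
    have "\<bar>(?fk - ?f) - ?m * (?gk - ?g)\<bar> \<le> \<bar>?fk - ?f\<bar> + \<bar>?m\<bar> * \<bar>?gk - ?g\<bar>"
      using abs_triangle_ineq4[of "?fk - ?f" "?m * (?gk - ?g)"] by (simp add: abs_mult)
    also have "\<dots> \<le> ?B + \<bar>?m\<bar> * ?B"
      using order_trans[OF f_fin_error[OF x] B] order_trans[OF g_fin_error[OF x] B]
      by (intro add_mono mult_left_mono) auto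
    finally show "\<bar>(?fk - ?f) - ?m * (?gk - ?g)\<bar> \<le> ?B * (1 + \<bar>?m\<bar>)"
      by (simp only: distrib_left mult_1_right mult.commute[of "\<bar>?m\<bar>"])
  qed (use gk pos in simp)
  also have "\<dots> \<le> (?B * (1 + \<bar>?m\<bar>)) / g_inf P x z"
    using gk pos C disc \<gamma> by (intro divide_left_mono mult_nonneg_nonneg) auto
  finally show ?thesis .
qed

end

theorem proposition7:
  fixes P :: project and w :: "real \<Rightarrow> real" and M \<gamma> :: real
  assumes "project_model P w M \<gamma>"
    and "\<forall>x\<in>states P. \<forall>z::ereal. g_inf P x z > 0"
  shows "(\<forall>x\<in>states P. \<forall>z::ereal. \<forall>k::nat.
        \<bar>m_fin P k x z - m_metric P x z\<bar>
          \<le> 2 * (M / (1 - \<gamma>)) * \<gamma> ^ k * w x * (1 + \<bar>m_metric P x z\<bar>) / g_inf P x z) \<and>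
    (\<forall>x\<in>states P. \<forall>k::nat.
        \<bar>m_fin_diag P k x - m_diag P x\<bar>
          \<le> 2 * (M / (1 - \<gamma>)) * \<gamma> ^ k * w x * (1 + \<bar>m_diag P x\<bar>) / g_inf P x (ereal x))"
proof -
  interpret project_model P w M \<gamma> by (rule assms(1))
  \<comment> \<open>The diagonal claim is the first one at the threshold
    \<open>z = ereal x\<close>.\<close>
  show ?thesis
    unfolding m_fin_diag_def m_diag_def using assms(2) by (intro conjI ballI allI m_fin_error) simp_all
qed

end
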